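(* Let $F$ be a field of characteristic $\neq 2$, let $\lambda\in F\setminus\{0,1\}$, and let $A$ be a primitive axial algebra of Jordan type $\lambda$ over $F$, generated by a set $\mathcal E$ of primitive axes of Jordan type $\lambda$. Then $A_0(a)^2\subseteq A_0(a)$ for every $a\in\mathcal E$.
   Context: Algebras are commutative and not necessarily associative. For an idempotent $a\in A$ and $\mu\in F$ put $A_\mu(a)=\{y\in A: ay=\mu y\}$ and $A_{0,1}(a)=A_1(a)+A_0(a)$. A $\lambda$-axis is an idempotent $a$ with $A=A_1(a)\oplus A_0(a)\oplus A_\lambda(a)$; it is primitive if $A_1(a)=Fa$. A $\lambda$-axis $a$ is of Jordan type $\lambda$ if $A_{0,1}(a)$ is a subalgebra, $A_{0,1}(a)A_\lambda(a)\subseteq A_\lambda(a)$, and $A_\lambda(a)^2\subseteq A_{0,1}(a)$ (the rule $A_0(a)^2\subseteq A_0(a)$ is not assumed). A primitive axial algebra of Jordan type $\lambda$ is a commutative algebra generated by a set $\mathcal E$ of primitive axes of Jordan type $\lambda$. *)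

theory Defs
  imports
    Complex_Main
    "HOL-Library.Set_Algebras"
    "HOL-Computational_Algebra.Computational_Algebra"
begin

text \<open>
  Commutative, not necessarily associative algebras without assumed unit over the field
  \<open>'f\<close>; the underlying space is the whole type \<open>'a\<close>.
\<close>

locale comm_algebra = vector_space scale
  for scale :: "'f::field \<Rightarrow> 'a::ab_group_add \<Rightarrow> 'a" (infixr "*s" 75) +
  fixes mult :: "'a \<Rightarrow> 'a \<Rightarrow> 'a" (infixl "\<cdot>" 70)
  assumes mult_commute: "x \<cdot> y = y \<cdot> x"
    and mult_add_left: "(x + y) \<cdot> z = x \<cdot> z + y \<cdot> z"
    and mult_scale_left: "(c *s x) \<cdot> y = c *s (x \<cdot> y)"
begin

definition subalgebra :: "'a set \<Rightarrow> bool" where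
  "subalgebra B \<longleftrightarrow> subspace B \<and> (\<forall>x\<in>B. \<forall>y\<in>B. x \<cdot> y \<in> B)"

definition product_space :: "'a set \<Rightarrow> 'a set \<Rightarrow> 'a set" where
  "product_space U V = span {x \<cdot> y | x y. x \<in> U \<and> y \<in> V}"

definition eigenspace :: "'f \<Rightarrow> 'a \<Rightarrow> 'a set" where
  "eigenspace \<mu> a = {y. a \<cdot> y = \<mu> *s y}"

text \<open>
  In the next definition, unique existence of the three components expresses that the whole
  space is the internal direct sum of the three eigenspaces. The idempotent 0 is not excluded.
\<close>

definition axis :: "'f \<Rightarrow> 'a \<Rightarrow> bool" where
  "axis \<eta> a \<longleftrightarrow> a \<cdot> a = a \<and>
     (\<forall>x. \<exists>!(u, v, w). u \<in> eigenspace 1 a \<and> v \<in> eigenspace 0 a \<and> w \<in> eigenspace \<eta> a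
                     \<and> x = u + v + w)"

definition primitive_axis :: "'f \<Rightarrow> 'a \<Rightarrow> bool" where
  "primitive_axis \<eta> a \<longleftrightarrow> axis \<eta> a \<and> eigenspace 1 a = range (\<lambda>c. c *s a)"

definition even_part :: "'a \<Rightarrow> 'a set" where
  "even_part a = eigenspace 1 a + eigenspace 0 a"

definition jordan_type :: "'f \<Rightarrow> 'a \<Rightarrow> bool" where
  "jordan_type \<eta> a \<longleftrightarrow> axis \<eta> a \<and>
     subalgebra (even_part a) \<and>
     product_space (even_part a) (eigenspace \<eta> a) \<subseteq> eigenspace \<eta> a \<and>
     product_space (eigenspace \<eta> a) (eigenspace \<eta> a) \<subseteq> even_part a"

end

locale primitive_axial_algebra = comm_algebra scale mult
  for scale :: "'f::field \<Rightarrow> 'a::ab_group_add \<Rightarrow> 'a" (infixr "*s" 75)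
    and mult :: "'a \<Rightarrow> 'a \<Rightarrow> 'a" (infixl "\<cdot>" 70) +
  fixes \<eta> :: 'f and \<E> :: "'a set"
  assumes primitive: "a \<in> \<E> \<Longrightarrow> primitive_axis \<eta> a"
    and jordan: "a \<in> \<E> \<Longrightarrow> jordan_type \<eta> a"
    and generated: "subalgebra hull \<E> = UNIV"

end

theory Submission
  imports Defs
begin

text \<open>
  Write \<open>\<phi>\<^sub>a x\<close> for the coefficient of \<open>a\<close> in the eigenspace decomposition of \<open>x\<close>. For nonzero axes
  \<open>a\<close> and \<open>b\<close> put \<open>\<sigma> = ab - \<eta>a - \<eta>b\<close>. It lies in the even part of \<open>a\<close> and of \<open>b\<close>, so
  \<open>b\<^sup>2 = b\<close> and \<open>a\<^sup>2 = a\<close> express \<open>\<sigma>\<^sup>2\<close> through \<open>a\<close>, \<open>b\<close>, \<open>\<sigma>\<close> in two ways, and comparing these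
  gives \<open>\<phi>\<^sub>a b = \<phi>\<^sub>b a\<close>. The Miyamoto involutions \<open>\<tau>\<^sub>a\<close> permute the axes, and since
  \<open>2 ab = 2 \<phi>\<^sub>a b a + \<eta> (b - \<tau>\<^sub>a b)\<close>, axes span the algebra and
  \<open>\<phi>\<^sub>a (bc) = \<phi>\<^sub>c (ba)\<close> for axes \<open>a\<close>, \<open>b\<close>, \<open>c\<close>. Hence \<open>\<phi>\<^sub>a (bx) = \<phi>\<^sub>b (ax)\<close> for all \<open>x\<close>. For
  \<open>x, y\<close> in the 0-eigenspace of \<open>a\<close>, writing \<open>y\<close> as a combination of axes \<open>b\<close> yields
  \<open>\<phi>\<^sub>a (xy) = 0\<close>.
\<close>

section \<open>Bilinearity of the product\<close>

context comm_algebra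
begin

lemma mult_add_right: "x \<cdot> (y + z) = x \<cdot> y + x \<cdot> z"
  by (metis mult_add_left mult_commute)

lemma mult_scale_right: "x \<cdot> (c *s y) = c *s (x \<cdot> y)"
  by (metis mult_scale_left mult_commute)

lemma mult_zero_left [simp]: "0 \<cdot> x = 0"
  by (metis mult_add_left add_cancel_right_right)

lemma mult_zero_right [simp]: "x \<cdot> 0 = 0"
  by (metis mult_zero_left mult_commute)

lemma mult_diff_left: "(x - y) \<cdot> z = x \<cdot> z - y \<cdot> z"
  by (metis mult_add_left add_diff_cancel diff_add_cancel)

lemma mult_diff_right: "x \<cdot> (y - z) = x \<cdot> y - x \<cdot> z"
  by (metis mult_diff_left mult_commute)

lemmas mult_linear = mult_add_left mult_add_right mult_diff_left mult_diff_right
  mult_scale_left mult_scale_right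

lemmas scale_distribs = scale_right_distrib scale_left_distrib
  scale_right_diff_distrib scale_left_diff_distrib

end

section \<open>Nonzero axes of Jordan type and their eigenspace decompositions\<close>

locale jordan_setting = comm_algebra scale mult
  for scale :: "'f::field \<Rightarrow> 'a::ab_group_add \<Rightarrow> 'a" (infixr "*s" 75)
    and mult :: "'a \<Rightarrow> 'a \<Rightarrow> 'a" (infixl "\<cdot>" 70) +
  fixes \<eta> :: 'f
  assumes eta_nz: "\<eta> \<noteq> 0" and eta_ne_1: "\<eta> \<noteq> 1" and two_nz: "(2::'f) \<noteq> 0"
begin

definition even :: "'a \<Rightarrow> 'a \<Rightarrow> bool" where
  "even a x \<longleftrightarrow> (\<exists>c v. a \<cdot> v = 0 \<and> x = c *s a + v)"

text \<open>The primitive axes of Jordan type other than 0, phrased with eigenvectors.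
  Decompositions are only required to exist, since \<open>decomp_unique\<close> supplies uniqueness;
  \<open>a \<noteq> 0\<close> makes the coefficient of \<open>a\<close> well determined.\<close>

definition jordan_axis :: "'a \<Rightarrow> bool" where
  "jordan_axis a \<longleftrightarrow> a \<noteq> 0 \<and> a \<cdot> a = a \<and>
     (\<forall>x. \<exists>c v w. a \<cdot> v = 0 \<and> a \<cdot> w = \<eta> *s w \<and> x = c *s a + v + w) \<and>
     (\<forall>v v'. a \<cdot> v = 0 \<longrightarrow> a \<cdot> v' = 0 \<longrightarrow> even a (v \<cdot> v')) \<and>
     (\<forall>v w. a \<cdot> v = 0 \<longrightarrow> a \<cdot> w = \<eta> *s w \<longrightarrow> a \<cdot> (v \<cdot> w) = \<eta> *s (v \<cdot> w)) \<and>
     (\<forall>w w'. a \<cdot> w = \<eta> *s w \<longrightarrow> a \<cdot> w' = \<eta> *s w' \<longrightarrow> even a (w \<cdot> w'))"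

lemma jordan_axisD:
  assumes "jordan_axis a"
  shows "a \<noteq> 0" "a \<cdot> a = a"
    and "\<exists>c v w. a \<cdot> v = 0 \<and> a \<cdot> w = \<eta> *s w \<and> x = c *s a + v + w"
    and "a \<cdot> v = 0 \<Longrightarrow> a \<cdot> v' = 0 \<Longrightarrow> even a (v \<cdot> v')"
    and "a \<cdot> v = 0 \<Longrightarrow> a \<cdot> w = \<eta> *s w \<Longrightarrow> a \<cdot> (v \<cdot> w) = \<eta> *s (v \<cdot> w)"
    and "a \<cdot> w = \<eta> *s w \<Longrightarrow> a \<cdot> w' = \<eta> *s w' \<Longrightarrow> even a (w \<cdot> w')"
  using assms unfolding jordan_axis_def by blast+

definition coeff :: "'a \<Rightarrow> 'a \<Rightarrow> 'f" where
  "coeff a x = (THE c. \<exists>v w. a \<cdot> v = 0 \<and> a \<cdot> w = \<eta> *s w \<and> x = c *s a + v + w)"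

text \<open>On the eigenvalues 1, 0, \<open>\<eta>\<close> the polynomial \<open>t\<^sup>2 - t\<close> takes the values 0, 0, \<open>\<eta> (\<eta> - 1)\<close>.\<close>

definition odd_comp :: "'a \<Rightarrow> 'a \<Rightarrow> 'a" where
  "odd_comp a x = inverse (\<eta> * (\<eta> - 1)) *s (a \<cdot> (a \<cdot> x) - a \<cdot> x)"

definition null_comp :: "'a \<Rightarrow> 'a \<Rightarrow> 'a" where
  "null_comp a x = x - coeff a x *s a - odd_comp a x"

text \<open>For a Jordan axis \<open>a\<close>, the identity on the even part and -1 on the
  \<open>\<eta>\<close>-eigenspace.\<close>

definition miyamoto :: "'a \<Rightarrow> 'a \<Rightarrow> 'a" where
  "miyamoto a x = x - 2 *s odd_comp a x"

lemma odd_comp_eqI: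
  assumes "a \<cdot> a = a" "a \<cdot> v = 0" "a \<cdot> w = \<eta> *s w"
  shows "odd_comp a (c *s a + v + w) = w"
proof -
  have "a \<cdot> (a \<cdot> (c *s a + v + w)) - a \<cdot> (c *s a + v + w) = (\<eta> * (\<eta> - 1)) *s w"
    using assms by (simp add: mult_linear algebra_simps scale_distribs)
  moreover have "\<eta> * (\<eta> - 1) \<noteq> 0"
    using eta_nz eta_ne_1 by simp
  moreover from this have "inverse (\<eta> * (\<eta> - 1)) * (\<eta> * (\<eta> - 1)) = 1"
    by (rule field_class.field_inverse)
  ultimately show ?thesis
    by (simp only: odd_comp_def scale_scale scale_one)
qed

text \<open>\<open>odd_comp\<close> reads off \<open>w\<close>; multiplying what remains by
  \<open>a\<close> kills the 0-eigenvector and leaves \<open>c *s a = c' *s a\<close> with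
  \<open>a \<noteq> 0\<close>.\<close>

lemma decomp_unique:
  assumes "jordan_axis a" "a \<cdot> v = 0" "a \<cdot> w = \<eta> *s w" "a \<cdot> v' = 0" "a \<cdot> w' = \<eta> *s w'"
    and eq: "c *s a + v + w = c' *s a + v' + w'"
  shows "c = c' \<and> v = v' \<and> w = w'"
proof -
  note a = jordan_axisD(1,2)[OF assms(1)]
  have w: "w = w'"
    using odd_comp_eqI[OF a(2) assms(2,3), of c] odd_comp_eqI[OF a(2) assms(4,5), of c'] eq
    by simp
  have eq': "c *s a + v = c' *s a + v'"
    using eq w by simp
  have "a \<cdot> (c *s a + v) = a \<cdot> (c' *s a + v')"
    using eq' by simp
  then have "c *s a = c' *s a"
    using a assms by (simp add: mult_linear)
  then show ?thesis
    using a eq' w by simp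
qed

lemma coeff_eqI:
  assumes "jordan_axis a" "a \<cdot> v = 0" "a \<cdot> w = \<eta> *s w"
  shows "coeff a (c *s a + v + w) = c"
  unfolding coeff_def
  using decomp_unique[OF assms(1)] assms(2,3) by (intro the_equality) metis+

lemma coeff_eq_zeroI: "jordan_axis a \<Longrightarrow> a \<cdot> v = 0 \<Longrightarrow> coeff a v = 0"
  using coeff_eqI[of a v 0 0] by simp

lemma
  assumes a: "jordan_axis a"
  shows decomp: "x = coeff a x *s a + null_comp a x + odd_comp a x"
    and mult_null_comp: "a \<cdot> null_comp a x = 0"
    and mult_odd_comp: "a \<cdot> odd_comp a x = \<eta> *s odd_comp a x"
proof -
  obtain c v w where *: "a \<cdot> v = 0" "a \<cdot> w = \<eta> *s w" "x = c *s a + v + w"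
    using jordan_axisD(3)[OF a] by blast
  have c: "coeff a x = c" and w: "odd_comp a x = w"
    using coeff_eqI[OF a] odd_comp_eqI jordan_axisD(2)[OF a] * by auto
  have "null_comp a x = v"
    using c w * by (simp add: null_comp_def)
  then show "x = coeff a x *s a + null_comp a x + odd_comp a x"
    "a \<cdot> null_comp a x = 0" "a \<cdot> odd_comp a x = \<eta> *s odd_comp a x"
    using c w * by simp_all
qed

lemma coeff_add:
  assumes a: "jordan_axis a"
  shows "coeff a (x + y) = coeff a x + coeff a y"
proof -
  have "x + y = (coeff a x *s a + null_comp a x + odd_comp a x)
      + (coeff a y *s a + null_comp a y + odd_comp a y)"
    by (simp only: decomp[OF a, symmetric])
  also have "\<dots> = (coeff a x + coeff a y) *s a + (null_comp a x + null_comp a y)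
      + (odd_comp a x + odd_comp a y)"
    by (simp add: scale_distribs algebra_simps)
  finally show ?thesis
    using coeff_eqI[OF a, of "null_comp a x + null_comp a y" "odd_comp a x + odd_comp a y"]
      mult_null_comp[OF a] mult_odd_comp[OF a] by (simp add: mult_linear scale_right_distrib)
qed

lemma coeff_scale:
  assumes a: "jordan_axis a"
  shows "coeff a (k *s x) = k * coeff a x"
proof -
  have "k *s x = k *s (coeff a x *s a + null_comp a x + odd_comp a x)"
    using decomp[OF a, of x] by simp
  also have "\<dots> = (k * coeff a x) *s a + k *s null_comp a x + k *s odd_comp a x"
    by (simp add: scale_distribs)
  finally show ?thesis
    using coeff_eqI[OF a, of "k *s null_comp a x" "k *s odd_comp a x"]
      mult_null_comp[OF a] mult_odd_comp[OF a] by (simp add: mult_linear scale_left_commute)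
qed

lemma coeff_diff: "jordan_axis a \<Longrightarrow> coeff a (x - y) = coeff a x - coeff a y"
  by (metis coeff_add add_diff_cancel diff_add_cancel)

subsection \<open>Miyamoto involutions\<close>

lemma even_add:
  assumes "even a x" "even a y"
  shows "even a (x + y)"
proof -
  obtain c v c' v' where "a \<cdot> v = 0" "x = c *s a + v" "a \<cdot> v' = 0" "y = c' *s a + v'"
    using assms unfolding even_def by blast
  then have "a \<cdot> (v + v') = 0" "x + y = (c + c') *s a + (v + v')"
    by (simp_all add: mult_linear scale_distribs algebra_simps)
  then show ?thesis
    unfolding even_def by blast
qed

lemma even_mult:
  assumes a: "jordan_axis a" and "even a x" "even a y"
  shows "even a (x \<cdot> y)"
proof -
  obtain c v c' v' where *: "a \<cdot> v = 0" "x = c *s a + v" "a \<cdot> v' = 0" "y = c' *s a + v'"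
    using assms unfolding even_def by blast
  have "x \<cdot> y = (c * c') *s a + v \<cdot> v'"
    using * jordan_axisD(2)[OF a] mult_commute[of v a] by (simp add: mult_linear scale_distribs)
  moreover have "even a ((c * c') *s a)"
    unfolding even_def by (metis add.right_neutral mult_zero_right)
  ultimately show ?thesis
    using even_add jordan_axisD(4)[OF a] * by simp
qed

lemma even_mult_odd:
  assumes a: "jordan_axis a" and "even a x" "a \<cdot> w = \<eta> *s w"
  shows "a \<cdot> (x \<cdot> w) = \<eta> *s (x \<cdot> w)"
proof -
  obtain c v where *: "a \<cdot> v = 0" "x = c *s a + v"
    using assms unfolding even_def by blast
  then show ?thesis
    using assms(3) jordan_axisD(5)[OF a]
    by (simp add: mult_linear scale_distribs scale_left_commute mult.commute)
qed

lemma even_odd_decomp: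
  assumes a: "jordan_axis a"
  obtains e where "even a e" "x = e + odd_comp a x"
  using decomp[OF a] mult_null_comp[OF a] unfolding even_def by blast

lemma odd_comp_even_odd:
  assumes a: "jordan_axis a" and "even a e" "a \<cdot> w = \<eta> *s w"
  shows "odd_comp a (e + w) = w"
  using assms odd_comp_eqI[OF jordan_axisD(2)[OF a]] unfolding even_def by auto

lemma miyamoto_even_odd:
  assumes "jordan_axis a" "even a e" "a \<cdot> w = \<eta> *s w"
  shows "miyamoto a (e + w) = e - w"
  using odd_comp_even_odd[OF assms] scale_left_distrib[of 1 1 w]
  by (simp add: miyamoto_def)

lemma miyamoto_add: "miyamoto a (x + y) = miyamoto a x + miyamoto a y"
  by (simp add: miyamoto_def odd_comp_def mult_linear scale_distribs algebra_simps)

lemma miyamoto_scale: "miyamoto a (c *s x) = c *s miyamoto a x"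
  by (simp add: miyamoto_def odd_comp_def mult_linear scale_distribs mult_ac)

lemma miyamoto_miyamoto:
  assumes a: "jordan_axis a"
  shows "miyamoto a (miyamoto a x) = x"
proof -
  obtain e where e: "even a e" "x = e + odd_comp a x"
    by (rule even_odd_decomp[OF a])
  let ?w = "odd_comp a x"
  have w: "a \<cdot> ?w = \<eta> *s ?w" "a \<cdot> (- ?w) = \<eta> *s (- ?w)"
    using mult_odd_comp[OF a] mult_diff_right[of a 0 ?w] by simp_all
  have "miyamoto a x = e + - ?w"
    using miyamoto_even_odd[OF a e(1) w(1)] e(2) by simp
  then show ?thesis
    using miyamoto_even_odd[OF a e(1) w(2)] e(2) by simp
qed

text \<open>The fusion rules grade the algebra by Z/2 into even part and
  \<open>\<eta>\<close>-eigenspace, and changing the sign of the odd part respects such a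
  grading.\<close>

lemma miyamoto_mult:
  assumes a: "jordan_axis a"
  shows "miyamoto a (x \<cdot> y) = miyamoto a x \<cdot> miyamoto a y"
proof -
  obtain e f where e: "even a e" "x = e + odd_comp a x" and f: "even a f" "y = f + odd_comp a y"
    by (metis even_odd_decomp[OF a])
  define v w where "v = odd_comp a x" and "w = odd_comp a y"
  have v: "a \<cdot> v = \<eta> *s v" and w: "a \<cdot> w = \<eta> *s w"
    using mult_odd_comp[OF a] by (simp_all add: v_def w_def)
  have x: "x = e + v" and y: "y = f + w"
    using e f by (simp_all add: v_def w_def)
  have ev: "even a (e \<cdot> f + v \<cdot> w)"
    by (intro even_add even_mult[OF a e(1) f(1)] jordan_axisD(6)[OF a v w])
  have od: "a \<cdot> (e \<cdot> w + f \<cdot> v) = \<eta> *s (e \<cdot> w + f \<cdot> v)"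
    using even_mult_odd[OF a e(1) w] even_mult_odd[OF a f(1) v]
    by (simp add: mult_linear scale_distribs)
  have "x \<cdot> y = (e \<cdot> f + v \<cdot> w) + (e \<cdot> w + f \<cdot> v)"
    by (simp add: x y mult_linear mult_commute[of f v])
  then have "miyamoto a (x \<cdot> y) = (e \<cdot> f + v \<cdot> w) - (e \<cdot> w + f \<cdot> v)"
    using miyamoto_even_odd[OF a ev od] by simp
  also have "\<dots> = (e - v) \<cdot> (f - w)"
    by (simp add: mult_linear mult_commute[of f v])
  finally show ?thesis
    using miyamoto_even_odd[OF a e(1) v] miyamoto_even_odd[OF a f(1) w] x y by simp
qed

text \<open>Since \<open>g\<close> is its own inverse, the eigenvectors of \<open>g a\<close> are
  the images under \<open>g\<close> of those of \<open>a\<close>, so every condition on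
  \<open>g a\<close> pulls back to \<open>a\<close>. The intended \<open>g\<close> are the Miyamoto
  involutions.\<close>

lemma involution_image:
  assumes add: "\<And>x y. g (x + y) = g x + g y" and scale: "\<And>c x. g (c *s x) = c *s g x"
    and mult: "\<And>x y. g (x \<cdot> y) = g x \<cdot> g y" and inv: "\<And>x. g (g x) = x"
    and a: "jordan_axis a"
  shows "jordan_axis (g a)" and "coeff (g a) (g x) = coeff a x"
proof -
  have g0: "g 0 = 0"
    using scale[of 0 0] by simp
  have eig: "g a \<cdot> x = c *s x \<longleftrightarrow> a \<cdot> g x = c *s g x" for x c
    by (metis scale mult inv)
  have null: "g a \<cdot> x = 0 \<longleftrightarrow> a \<cdot> g x = 0" for x
    using eig[of x 0] by simp
  have even: "even (g a) x" if "even a (g x)" for x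
  proof -
    obtain c v where "a \<cdot> v = 0" "g x = c *s a + v"
      using \<open>even a (g x)\<close> unfolding even_def by blast
    then have "g a \<cdot> g v = 0" "x = c *s g a + g v"
      by (metis null inv, metis add scale inv)
    then show ?thesis
      unfolding even_def by blast
  qed
  show ax: "jordan_axis (g a)"
    unfolding jordan_axis_def
  proof (intro conjI allI impI)
    show "g a \<noteq> 0" "g a \<cdot> g a = g a"
      using jordan_axisD(1,2)[OF a] g0 inv mult by metis+
  next
    fix x
    obtain c v w where "a \<cdot> v = 0" "a \<cdot> w = \<eta> *s w" "g x = c *s a + v + w"
      using jordan_axisD(3)[OF a] by blast
    then have "g a \<cdot> g v = 0 \<and> g a \<cdot> g w = \<eta> *s g w \<and> x = c *s g a + g v + g w"
      by (metis null eig add scale inv)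
    then show "\<exists>c v w. g a \<cdot> v = 0 \<and> g a \<cdot> w = \<eta> *s w \<and> x = c *s g a + v + w"
      by blast
  next
    fix v v' assume "g a \<cdot> v = 0" "g a \<cdot> v' = 0"
    then show "even (g a) (v \<cdot> v')"
      using even jordan_axisD(4)[OF a] null mult by metis
  next
    fix v w assume "g a \<cdot> v = 0" "g a \<cdot> w = \<eta> *s w"
    then show "g a \<cdot> (v \<cdot> w) = \<eta> *s (v \<cdot> w)"
      using jordan_axisD(5)[OF a] null eig mult by metis
  next
    fix w w' assume "g a \<cdot> w = \<eta> *s w" "g a \<cdot> w' = \<eta> *s w'"
    then show "even (g a) (w \<cdot> w')"
      using even jordan_axisD(6)[OF a] eig mult by metis
  qed
  have "g x = coeff a x *s g a + g (null_comp a x) + g (odd_comp a x)"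
    by (metis decomp[OF a] add scale)
  moreover have "g a \<cdot> g (null_comp a x) = 0" "g a \<cdot> g (odd_comp a x) = \<eta> *s g (odd_comp a x)"
    using null eig inv mult_null_comp[OF a] mult_odd_comp[OF a] by simp_all
  ultimately show "coeff (g a) (g x) = coeff a x"
    using coeff_eqI[OF ax] by metis
qed

lemma
  assumes "jordan_axis b" "jordan_axis a"
  shows jordan_axis_miyamoto: "jordan_axis (miyamoto b a)"
    and coeff_miyamoto: "coeff (miyamoto b a) (miyamoto b x) = coeff a x"
  using involution_image[of "miyamoto b"] miyamoto_add miyamoto_scale miyamoto_mult[OF assms(1)]
    miyamoto_miyamoto[OF assms(1)] assms(2) by blast+

lemma axis_mult:
  assumes a: "jordan_axis a"
  shows "a \<cdot> x = coeff a x *s a + \<eta> *s odd_comp a x"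
proof -
  have "a \<cdot> x = a \<cdot> (coeff a x *s a + null_comp a x + odd_comp a x)"
    using decomp[OF a, of x] by simp
  then show ?thesis
    using jordan_axisD(2)[OF a] mult_null_comp[OF a] mult_odd_comp[OF a] by (simp add: mult_linear)
qed

text \<open>Eliminates \<open>odd_comp\<close>: for an axis \<open>x\<close> the right side is a
  combination of axes, as \<open>miyamoto a x\<close> is again an axis.\<close>

lemma axis_mult_miyamoto:
  assumes "jordan_axis a"
  shows "a \<cdot> x = coeff a x *s a + (\<eta> / 2) *s (x - miyamoto a x)"
  using axis_mult[OF assms] two_nz by (simp add: miyamoto_def)

subsection \<open>Two axes\<close>

text \<open>The special case to which \<open>coeff_sym\<close> is reduced. Components with respect
  to \<open>a\<close> force \<open>\<beta>\<close> to be 0 or \<open>\<eta>\<close>; exchanging the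
  axes does the same for \<open>\<alpha>\<close>.\<close>

lemma coeff_sym_if_dependent:
  assumes a: "jordan_axis a" and b: "jordan_axis b"
    and ab: "a \<cdot> b = \<alpha> *s a + \<beta> *s b"
  shows "coeff a b = coeff b a"
proof (cases "a = b")
  case False
  have *: "\<beta> = 0 \<and> coeff a b = \<alpha> \<or> \<beta> = \<eta> \<and> coeff a b * (1 - \<eta>) = \<alpha>"
    if a: "jordan_axis a" and b: "jordan_axis b" and ne: "a \<noteq> b"
      and ab: "a \<cdot> b = \<alpha> *s a + \<beta> *s b"
    for a b \<alpha> \<beta>
  proof -
    define p v w where "p = coeff a b" and "v = null_comp a b" and "w = odd_comp a b"
    have v: "a \<cdot> v = 0" and w: "a \<cdot> w = \<eta> *s w" and bd: "b = p *s a + v + w"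
      using decomp[OF a] mult_null_comp[OF a] mult_odd_comp[OF a]
      by (simp_all add: p_def v_def w_def)
    \<comment> \<open>Expanding \<open>b\<close> on the left gives two decompositions with respect
      to \<open>a\<close>; the one of \<open>a \<cdot> b\<close> has 0-component 0.\<close>
    have "\<alpha> *s a + \<beta> *s b = p *s a + \<eta> *s w"
      using axis_mult[OF a, of b] ab by (simp add: p_def w_def)
    then have "(\<alpha> + \<beta> * p) *s a + \<beta> *s v + \<beta> *s w = p *s a + 0 + \<eta> *s w"
      by (subst (asm) bd) (simp add: scale_distribs algebra_simps)
    then have *: "\<alpha> + \<beta> * p = p \<and> \<beta> *s v = 0 \<and> \<beta> *s w = \<eta> *s w"
      using v w by (intro decomp_unique[OF a]) (simp_all add: mult_linear scale_left_commute)
    \<comment> \<open>A nonzero \<open>v\<close> forces \<open>\<beta> = 0\<close>, a nonzero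
      \<open>w\<close> forces \<open>\<beta> = \<eta>\<close>. If both vanished, the idempotent
      \<open>b\<close> would be a multiple of \<open>a\<close>, hence 0 or \<open>a\<close>.\<close>
    moreover have "v \<noteq> 0 \<or> w \<noteq> 0"
    proof (rule ccontr)
      assume "\<not> ?thesis"
      then have "b = p *s a"
        using bd by simp
      moreover from this have "(p * p) *s a = p *s a"
        using jordan_axisD(2)[OF a] jordan_axisD(2)[OF b] by (simp add: mult_linear)
      ultimately show False
        using ne jordan_axisD(1)[OF a] jordan_axisD(1)[OF b] by auto
    qed
    ultimately have "\<beta> = 0 \<and> p = \<alpha> \<or> \<beta> = \<eta> \<and> p * (1 - \<eta>) = \<alpha>"
      by (auto simp: algebra_simps)
    then show ?thesis
      by (simp add: p_def)
  qed
  \<comment> \<open>An \<open>\<eta>\<close>-eigenvector of \<open>b\<close> has an even square. As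
    \<open>a\<close> is its own square, it would be both even and odd, hence 0.\<close>
  have not_odd: "b \<cdot> a \<noteq> \<eta> *s a" if a: "jordan_axis a" and b: "jordan_axis b" for a b
  proof
    assume ba: "b \<cdot> a = \<eta> *s a"
    then have "even b a"
      using jordan_axisD(6)[OF b ba ba] jordan_axisD(2)[OF a] by simp
    then obtain c v where "b \<cdot> v = 0" "a = c *s b + v"
      unfolding even_def by blast
    then have "a = 0"
      using decomp_unique[OF b, of v 0 0 a c 0] ba by simp
    then show False
      using jordan_axisD(1)[OF a] by simp
  qed
  have ba: "b \<cdot> a = \<beta> *s b + \<alpha> *s a"
    using ab mult_commute[of a b] by (simp add: add.commute)
  \<comment> \<open>The mixed pairs would make \<open>a \<cdot> b\<close> equal to
    \<open>\<eta> *s a\<close> or \<open>\<eta> *s b\<close>; the remaining pairs, with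
    \<open>\<alpha> = \<beta>\<close>, give equal coefficients.\<close>
  have "\<not> (\<alpha> = \<eta> \<and> \<beta> = 0)" "\<not> (\<alpha> = 0 \<and> \<beta> = \<eta>)"
    using not_odd[OF a b] not_odd[OF b a] ab ba by auto
  moreover have "coeff a b = coeff b a" if "coeff a b * (1 - \<eta>) = coeff b a * (1 - \<eta>)"
    using that eta_ne_1 by simp
  ultimately show ?thesis
    using *[OF a b False ab] *[OF b a False[symmetric] ba] by metis
qed simp

text \<open>Both sides compute \<open>2 *s (s \<cdot> (\<eta> *s w))\<close> for the odd component
  \<open>w\<close> of \<open>b\<close>: the left expands \<open>\<eta> *s w\<close> in
  \<open>s\<close>, \<open>a\<close>, \<open>b\<close>, the right uses that multiplication by
  \<open>s\<close> scales \<open>w\<close>. As \<open>s\<close> is symmetric in the axes, exchanging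
  them gives a second formula for \<open>s \<cdot> s\<close>.\<close>

lemma sigma_relation:
  assumes a: "jordan_axis a" and b: "jordan_axis b"
  defines "p \<equiv> coeff a b" and "q \<equiv> coeff b a" and "s \<equiv> a \<cdot> b - \<eta> *s a - \<eta> *s b"
  shows "2 *s (s \<cdot> s) + (2 * (\<eta> - p) * (p - \<eta> - \<eta> * p)) *s a + (2 * \<eta> * (q - \<eta> - \<eta> * q)) *s b
    = (\<eta> * (2 * p - 2 * \<eta> - 1)) *s (s + (\<eta> - p) *s a + \<eta> *s b)"
proof -
  \<comment> \<open>Stated for arbitrary axes, to be used for \<open>a\<close> and for
    \<open>b\<close>.\<close>
  have s_mult: "s \<cdot> a = (p - \<eta> - \<eta> * p) *s a \<and> s = (p - \<eta> - \<eta> * p) *s a - \<eta> *s null_comp a b"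
    if a: "jordan_axis a" and p: "p = coeff a b" and s: "s = a \<cdot> b - \<eta> *s a - \<eta> *s b"
    for a b p s
  proof -
    have "s = p *s a + \<eta> *s odd_comp a b - \<eta> *s a
        - \<eta> *s (p *s a + null_comp a b + odd_comp a b)"
      using axis_mult[OF a, of b] decomp[OF a, of b] s p by simp
    then have "s = (p - \<eta> - \<eta> * p) *s a - \<eta> *s null_comp a b"
      by (simp add: scale_distribs algebra_simps)
    moreover from this have "s \<cdot> a = (p - \<eta> - \<eta> * p) *s a"
      using jordan_axisD(2)[OF a] mult_null_comp[OF a, of b] mult_commute[of "null_comp a b" a]
      by (simp add: mult_linear)
    ultimately show ?thesis by simp
  qed
  have sb: "s \<cdot> b = (q - \<eta> - \<eta> * q) *s b"
    using s_mult[OF b, of q a s] mult_commute[of a b] by (simp add: q_def s_def algebra_simps)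
  have sa: "s \<cdot> a = (p - \<eta> - \<eta> * p) *s a" and sd: "s = (p - \<eta> - \<eta> * p) *s a - \<eta> *s null_comp a b"
    using s_mult[OF a refl refl, of b] unfolding p_def s_def by blast+
  define v w where "v = null_comp a b" and "w = odd_comp a b"
  have v: "a \<cdot> v = 0" and w: "a \<cdot> w = \<eta> *s w" and bd: "b = p *s a + v + w"
    using decomp[OF a] mult_null_comp[OF a] mult_odd_comp[OF a]
    by (simp_all add: p_def v_def w_def)
  \<comment> \<open>the odd part of \<open>b \<cdot> b = b\<close>\<close>
  have vw: "2 *s (v \<cdot> w) = (1 - 2 * \<eta> * p) *s w"
  proof -
    let ?e = "(p * p) *s a + (v \<cdot> v + w \<cdot> w)"
    let ?o = "2 *s (v \<cdot> w) + (2 * \<eta> * p) *s w"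
    have 2: "2 *s x = x + x" for x
      using scale_left_distrib[of 1 1 x] by simp
    have "even a ((p * p) *s a)"
      unfolding even_def by (metis add.right_neutral mult_zero_right)
    then have ev: "even a ?e"
      using even_add jordan_axisD(4)[OF a v v] jordan_axisD(6)[OF a w w] by blast
    have od: "a \<cdot> ?o = \<eta> *s ?o"
      using jordan_axisD(5)[OF a v w] w
      by (simp add: mult_linear scale_right_distrib mult_ac)
    have "b \<cdot> b = p *s p *s a + p *s \<eta> *s w + (v \<cdot> v + v \<cdot> w) + (p *s \<eta> *s w + v \<cdot> w + w \<cdot> w)"
      using v w jordan_axisD(2)[OF a] mult_commute[of v a] mult_commute[of w a] mult_commute[of w v]
      unfolding bd by (simp add: mult_linear scale_distribs)
    moreover have "(2 * \<eta> * p) *s w = (p * \<eta>) *s w + (p * \<eta>) *s w"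
      by (simp add: scale_left_distrib[symmetric])
    ultimately have "b \<cdot> b = ?e + ?o"
      by (simp add: 2 add_ac)
    then have "b = ?e + ?o"
      unfolding jordan_axisD(2)[OF b] .
    then have "w = odd_comp a (?e + ?o)"
      by (rule arg_cong[of b "?e + ?o" "odd_comp a", folded w_def])
    then have "w = ?o"
      unfolding odd_comp_even_odd[OF a ev od] .
    then have "w - (2 * \<eta> * p) *s w = 2 *s (v \<cdot> w)"
      by (rule iffD2[OF diff_eq_eq])
    then show ?thesis
      by (simp add: scale_left_diff_distrib)
  qed
  have ew: "\<eta> *s w = s + (\<eta> - p) *s a + \<eta> *s b"
    using axis_mult[OF a, of b] by (simp add: s_def w_def p_def scale_distribs)
  \<comment> \<open>The terms in \<open>\<eta> * \<eta> * p\<close> cancel in \<open>?k\<close>, so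
    its values for \<open>p\<close> and \<open>q\<close> differ by
    \<open>2 * \<eta> * (p - q)\<close>.\<close>
  let ?r = "p - \<eta> - \<eta> * p" and ?k = "\<eta> * (2 * p - 2 * \<eta> - 1)"
  have k: "2 * (?r * \<eta>) - \<eta> * (1 - 2 * \<eta> * p) = ?k"
    by (simp add: algebra_simps)
  \<comment> \<open>As \<open>s\<close> is a combination of \<open>a\<close> and \<open>v\<close>,
    the relation \<open>vw\<close> makes \<open>s \<cdot> w\<close> a multiple of
    \<open>w\<close>.\<close>
  have "s \<cdot> w = (?r * \<eta>) *s w - \<eta> *s (v \<cdot> w)"
    by (subst sd) (simp add: mult_linear w v_def)
  then have "2 *s (s \<cdot> w) = (2 * (?r * \<eta>)) *s w - \<eta> *s 2 *s (v \<cdot> w)"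
    by (simp add: scale_right_diff_distrib mult.commute)
  then have "2 *s (s \<cdot> w) = ?k *s w"
    unfolding vw scale_scale scale_left_diff_distrib[symmetric] k .
  then have "\<eta> *s 2 *s (s \<cdot> w) = \<eta> *s ?k *s w"
    by (rule arg_cong)
  then have "2 *s (s \<cdot> (\<eta> *s w)) = ?k *s (\<eta> *s w)"
    unfolding mult_scale_right by (subst (1 2) scale_left_commute)
  then show ?thesis
    unfolding ew mult_add_right mult_scale_right sa sb scale_right_distrib scale_scale mult.assoc .
qed

text \<open>Both instances of \<open>sigma_relation\<close> begin with
  \<open>2 *s (s \<cdot> s)\<close>; subtracting them puts
  \<open>(2 * \<eta> * (p - q)) *s s\<close> into the span of \<open>a\<close> and \<open>b\<close>.
  If \<open>p \<noteq> q\<close>, then \<open>a \<cdot> b\<close> lies there too, and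
  \<open>coeff_sym_if_dependent\<close> applies.\<close>

lemma coeff_sym:
  assumes a: "jordan_axis a" and b: "jordan_axis b"
  shows "coeff a b = coeff b a"
proof (rule ccontr)
  assume ne: "coeff a b \<noteq> coeff b a"
  define p q s where "p = coeff a b" and "q = coeff b a" and "s = a \<cdot> b - \<eta> *s a - \<eta> *s b"
  have s': "b \<cdot> a - \<eta> *s b - \<eta> *s a = s"
    using mult_commute[of a b] by (simp add: s_def algebra_simps)
  let ?k = "2 * \<eta> * (p - q)"
  let ?x = "2 *s (s \<cdot> s)"
  \<comment> \<open>Only the factors on the right, which become the coefficients of
    \<open>s\<close>, matter; the other coefficients are hidden behind names.\<close>
  obtain A B C D where
    1: "?x + A *s a + B *s b = (\<eta> * (2 * p - 2 * \<eta> - 1)) *s (s + C *s a + D *s b)"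
    using sigma_relation[OF a b] unfolding p_def[symmetric] s_def[symmetric] by (rule that)
  obtain A' B' C' D' where
    2: "?x + B' *s b + A' *s a = (\<eta> * (2 * q - 2 * \<eta> - 1)) *s (s + D' *s b + C' *s a)"
    using sigma_relation[OF b a] unfolding s' q_def[symmetric] by (rule that)
  define m n where "m = \<eta> * (2 * p - 2 * \<eta> - 1)" and "n = \<eta> * (2 * q - 2 * \<eta> - 1)"
  have "m *s s - n *s s = (A - A' - m * C + n * C') *s a + (B - B' - m * D + n * D') *s b"
  proof -
    have x: "m *s s = ?x + A *s a + B *s b - (m * C) *s a - (m * D) *s b"
      using 1 unfolding m_def[symmetric] by (simp add: scale_right_distrib)
    have y: "n *s s = ?x + A' *s a + B' *s b - (n * C') *s a - (n * D') *s b"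
      using 2 unfolding n_def[symmetric] by (simp add: scale_right_distrib algebra_simps)
    show ?thesis
      unfolding x y by (simp add: scale_distribs algebra_simps)
  qed
  moreover have "m - n = ?k"
    by (simp add: m_def n_def algebra_simps)
  ultimately obtain E G where "?k *s s = E *s a + G *s b"
    by (metis scale_left_diff_distrib)
  then have "inverse ?k *s ?k *s s = inverse ?k *s (E *s a + G *s b)"
    by simp
  moreover have "inverse ?k * ?k = 1"
    using ne eta_nz two_nz by (intro field_class.field_inverse) (simp add: p_def q_def)
  ultimately have "s = (inverse ?k * E) *s a + (inverse ?k * G) *s b"
    by (simp only: scale_scale scale_right_distrib scale_one)
  then have "a \<cdot> b = (inverse ?k * E + \<eta>) *s a + (inverse ?k * G + \<eta>) *s b"
    by (simp add: s_def scale_left_distrib algebra_simps)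
  then show False
    using coeff_sym_if_dependent[OF a b] ne by blast
qed

subsection \<open>Algebras spanned by axes\<close>

text \<open>Expand both products by \<open>axis_mult_miyamoto\<close> at the common axis
  \<open>b\<close>; \<open>coeff_sym\<close> matches all terms except those with
  \<open>miyamoto b\<close>.\<close>

lemma coeff_mult_axes:
  assumes a: "jordan_axis a" and b: "jordan_axis b" and c: "jordan_axis c"
  shows "coeff a (b \<cdot> c) = coeff c (b \<cdot> a)"
proof -
  have *: "coeff a (b \<cdot> c) = coeff b c * coeff a b + \<eta> / 2 * (coeff a c - coeff a (miyamoto b c))"
    if a: "jordan_axis a" for a c
    unfolding axis_mult_miyamoto[OF b, of c] using a
    by (simp add: coeff_add coeff_scale coeff_diff)
  \<comment> \<open>Symmetry turns the left side into \<open>coeff (miyamoto b a) c\<close>;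
    applying the automorphism \<open>miyamoto b\<close> to both arguments gives the right
    side.\<close>
  have "coeff c (miyamoto b a) = coeff a (miyamoto b c)"
    using coeff_sym[OF c jordan_axis_miyamoto[OF b a]] coeff_miyamoto[OF b a, of "miyamoto b c"]
    by (simp add: miyamoto_miyamoto[OF b])
  then show ?thesis
    using *[OF a, of c] *[OF c, of a] coeff_sym a b c by simp
qed

text \<open>A product of axes \<open>a\<close> and \<open>b\<close> is a combination of
  \<open>a\<close> and the axes \<open>b\<close> and \<open>miyamoto a b\<close>; bilinearity does
  the rest.\<close>

lemma subalgebra_span_axes: "subalgebra (span {a. jordan_axis a})"
  unfolding subalgebra_def
proof (intro conjI ballI)
  let ?S = "span {a. jordan_axis a}"
  have ab: "a \<cdot> b \<in> ?S" if a: "jordan_axis a" and b: "jordan_axis b" for a b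
  proof -
    have "a \<in> ?S" "b \<in> ?S" "miyamoto a b \<in> ?S"
      using a b jordan_axis_miyamoto by (simp_all add: span_base)
    then show ?thesis
      unfolding axis_mult_miyamoto[OF a] by (intro span_add span_scale span_diff)
  qed
  have ay: "a \<cdot> y \<in> ?S" if a: "jordan_axis a" and y: "y \<in> ?S" for a y
    using y
  proof (induction rule: span_induct_alt)
    case base
    show ?case by (simp add: span_zero)
  next
    case (step c b y)
    then show ?case
      using ab[OF a, of b] by (simp add: mult_linear span_add span_scale)
  qed
  fix x y assume "x \<in> ?S" and y: "y \<in> ?S"
  from \<open>x \<in> ?S\<close> show "x \<cdot> y \<in> ?S"
  proof (induction rule: span_induct_alt)
    case base
    show ?case by (simp add: span_zero)
  next
    case (step c a x)
    then show ?case
      using ay[OF _ y, of a] by (simp add: mult_linear span_add span_scale)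
  qed
qed simp

text \<open>Both sides are linear in \<open>x\<close>, and for an axis \<open>x\<close> this is
  \<open>coeff_mult_axes\<close>.\<close>

lemma coeff_mult_swap:
  assumes span: "span {a. jordan_axis a} = UNIV" and a: "jordan_axis a" and b: "jordan_axis b"
  shows "coeff a (b \<cdot> x) = coeff b (a \<cdot> x)"
proof -
  have "x \<in> span {a. jordan_axis a}"
    using span by simp
  then show ?thesis
  proof (induction rule: span_induct_alt)
    case base
    show ?case using a b by (simp add: coeff_eq_zeroI)
  next
    case (step c d y)
    have "coeff a (b \<cdot> d) = coeff b (a \<cdot> d)"
      using coeff_mult_axes[OF a, of d b] step(1) b by (simp add: mult_commute)
    then show ?case
      using step a b by (simp add: mult_linear coeff_add coeff_scale)
  qed
qed

text \<open>For each axis \<open>b\<close>,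
  \<open>coeff a (x \<cdot> b) = coeff b (a \<cdot> x) = 0\<close>, so linearity gives
  \<open>coeff a (x \<cdot> y) = 0\<close>. As the product is even, only a 0-eigenvector
  remains.\<close>

lemma null_mult_null:
  assumes span: "span {a. jordan_axis a} = UNIV" and a: "jordan_axis a"
    and x: "a \<cdot> x = 0" and y: "a \<cdot> y = 0"
  shows "a \<cdot> (x \<cdot> y) = 0"
proof -
  have "y \<in> span {a. jordan_axis a}"
    using span by simp
  then have 0: "coeff a (x \<cdot> y) = 0"
  proof (induction rule: span_induct_alt)
    case base
    show ?case using a by (simp add: coeff_eq_zeroI)
  next
    case (step c b z)
    then show ?case
      using a coeff_mult_swap[OF span a, of b x] x mult_commute[of x b]
      by (simp add: mult_linear coeff_add coeff_scale coeff_eq_zeroI)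
  qed
  obtain c v where v: "a \<cdot> v = 0" "x \<cdot> y = c *s a + v"
    using jordan_axisD(4)[OF a x y] unfolding even_def by blast
  then have "c = 0"
    using 0 coeff_eqI[OF a v(1), of 0 c] by simp
  then show ?thesis
    using v by simp
qed

section \<open>From eigenspaces to eigenvectors in the notion of an axis\<close>

lemma jordan_axisI:
  assumes prim: "primitive_axis \<eta> a" and jt: "jordan_type \<eta> a" and "a \<noteq> 0"
  shows "jordan_axis a"
proof -
  have ax: "axis \<eta> a" and one: "eigenspace 1 a = range (\<lambda>c. c *s a)"
    using prim by (simp_all add: primitive_axis_def)
  \<comment> \<open>Primitivity reduces the 1-eigenspace to the multiples of
    \<open>a\<close>.\<close>
  have ev: "even a x \<longleftrightarrow> x \<in> even_part a" for x
  proof -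
    have "x \<in> even_part a \<longleftrightarrow> (\<exists>c. \<exists>v \<in> eigenspace 0 a. x = c *s a + v)"
      unfolding even_part_def one set_plus_def by blast
    then show ?thesis
      unfolding even_def by (simp add: eigenspace_def Bex_def)
  qed
  have null: "even a v" if "a \<cdot> v = 0" for v
    using that unfolding even_def by (metis add_0 scale_zero_left)
  have eo: "a \<cdot> (x \<cdot> w) = \<eta> *s (x \<cdot> w)" if "even a x" "a \<cdot> w = \<eta> *s w" for x w
  proof -
    have "x \<in> even_part a" "w \<in> eigenspace \<eta> a"
      using that ev by (simp_all add: eigenspace_def)
    then have "x \<cdot> w \<in> product_space (even_part a) (eigenspace \<eta> a)"
      unfolding product_space_def by (intro span_base) blast
    then show ?thesis
      using jt by (auto simp: jordan_type_def eigenspace_def)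
  qed
  have oo: "even a (w \<cdot> w')" if "a \<cdot> w = \<eta> *s w" "a \<cdot> w' = \<eta> *s w'" for w w'
  proof -
    have "w \<in> eigenspace \<eta> a" "w' \<in> eigenspace \<eta> a"
      using that by (simp_all add: eigenspace_def)
    then have "w \<cdot> w' \<in> product_space (eigenspace \<eta> a) (eigenspace \<eta> a)"
      unfolding product_space_def by (intro span_base) blast
    then show ?thesis
      using jt by (auto simp: jordan_type_def ev)
  qed
  have ee: "even a (x \<cdot> y)" if "even a x" "even a y" for x y
    using jt that by (auto simp: ev jordan_type_def subalgebra_def)
  have dec: "\<exists>c v w. a \<cdot> v = 0 \<and> a \<cdot> w = \<eta> *s w \<and> x = c *s a + v + w" for x
  proof -
    obtain p where p: "case p of (u, v, w) \<Rightarrow> u \<in> eigenspace 1 a \<and> v \<in> eigenspace 0 a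
        \<and> w \<in> eigenspace \<eta> a \<and> x = u + v + w"
      using ex1_implies_ex[OF spec[OF conjunct2[OF ax[unfolded axis_def]], of x]] by (elim exE)
    obtain u v w where "p = (u, v, w)"
      by (cases p)
    then have "u \<in> range (\<lambda>c. c *s a) \<and> v \<in> eigenspace 0 a \<and> w \<in> eigenspace \<eta> a
        \<and> x = u + v + w"
      using p one by simp
    then show ?thesis
      by (auto simp: eigenspace_def)
  qed
  show ?thesis
    unfolding jordan_axis_def
    using \<open>a \<noteq> 0\<close> conjunct1[OF ax[unfolded axis_def]] dec ee[OF null null] eo[OF null] oo
    by (intro conjI allI impI)
qed

end

theorem corollary3p2:
  fixes scale :: "'f::field \<Rightarrow> 'a::ab_group_add \<Rightarrow> 'a"
    and mult :: "'a \<Rightarrow> 'a \<Rightarrow> 'a"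
    and \<eta> :: 'f
    and \<E> :: "'a set"
  assumes "CHAR('f) \<noteq> 2"
    and "\<eta> \<notin> {0, 1}"
    and "primitive_axial_algebra scale mult \<eta> \<E>"
  shows "\<forall>a\<in>\<E>. comm_algebra.product_space scale mult
                  (comm_algebra.eigenspace scale mult 0 a) (comm_algebra.eigenspace scale mult 0 a)
                \<subseteq> comm_algebra.eigenspace scale mult 0 a"
proof -
  interpret primitive_axial_algebra scale mult \<eta> \<E>
    by (rule assms(3))
  \<comment> \<open>Otherwise the characteristic divides the prime 2 and, never being 1, equals
    2.\<close>
  have "(2::'f) \<noteq> 0"
  proof
    assume "(2::'f) = 0"
    then have "of_nat 2 = (0::'f)"
      by simp
    then have "CHAR('f) dvd 2"
      by (simp only: of_nat_eq_0_iff_char_dvd)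
    then show False
      using assms(1) CHAR_not_1'[where 'a = 'f] two_is_prime_nat unfolding prime_nat_iff by auto
  qed
  then interpret jordan_setting scale mult \<eta>
    using assms(2) by unfold_locales auto
  \<comment> \<open>The zero vector may be a generator; it lies in every span, and for
    \<open>a = 0\<close> the claim is immediate.\<close>
  have axis: "jordan_axis a" if "a \<in> \<E>" "a \<noteq> 0" for a
    using jordan_axisI primitive jordan that by blast
  have "\<E> \<subseteq> span {a. jordan_axis a}"
    using axis span_base span_zero by blast
  then have "subalgebra hull \<E> \<subseteq> span {a. jordan_axis a}"
    using subalgebra_span_axes by (rule hull_minimal)
  then have span: "span {a. jordan_axis a} = UNIV"
    using generated by blast
  show ?thesis
  proof
    fix a assume "a \<in> \<E>"
    \<comment> \<open>\<open>product_space\<close> is a span, so it suffices to place the products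
      themselves in a subspace.\<close>
    have sub: "subspace (eigenspace 0 a)"
      by (auto simp: subspace_def eigenspace_def mult_linear)
    have "mult a (mult x y) = 0" if "mult a x = 0" "mult a y = 0" for x y
      using that axis[OF \<open>a \<in> \<E>\<close>] null_mult_null[OF span] by (cases "a = 0") auto
    then show "product_space (eigenspace 0 a) (eigenspace 0 a) \<subseteq> eigenspace 0 a"
      unfolding product_space_def by (intro span_minimal sub) (auto simp: eigenspace_def)
  qed
qed

end
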